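(* Implicative-orthomodular algebras are definitionally equivalent to orthomodular algebras, via the mutually inverse transformations $\Phi: x\odot y:=(x\to y^* )^*$ and $\Psi: x\to y:=(x\odot y^* )^*$. That is: if $(X,\to,0,1)$ is an implicative-orthomodular algebra and $x^*:=x\to 0$, $x\odot y:=(x\to y^* )^*$, then $(X,\odot,{}^*,1)$ is an orthomodular algebra; if $(X,\odot,{}^*,1)$ is an orthomodular algebra and $0:=1^*$, $x\to y:=(x\odot y^* )^*$, then $(X,\to,0,1)$ is an implicative-orthomodular algebra; and these two transformations are inverse to each other.
   Context: A BE algebra is an algebra $(X,\to,1)$ of type $(2,0)$ such that for all $x,y,z\in X$: $x\to x=1$; $x\to 1=1$; $1\to x=x$; $x\to(y\to z)=y\to(x\to z)$. Put $x\le y$ iff $x\to y=1$. It is bounded if there is $0\in X$ with $0\le x$ for all $x\in X$; then $x^*:=x\to 0$. It is involutive if it is bounded and $x^{**}=x$ for all $x$. In an involutive BE algebra $(X,\to,0,1)$ define $x\Cap y:=((x^*\to y^* )\to y^* )^*$. An implicative-orthomodular algebra (IOM algebra) is an involutive BE algebra satisfying $x\Cap(y\to x)=x$ for all $x,y\in X$. A (left-)m-BE algebra is an algebra $(X,\odot,{}^{*},1)$ of type $(2,1,0)$ such that, with $0:=1^*$, for all $x,y,z\in X$: $1\odot x=x=x\odot 1$; $x\odot y=y\odot x$; $x\odot(y\odot z)=(x\odot y)\odot z$; $x\odot 0=0$; $x\odot x^*=0$. It is involutive if $x^{**}=x$ for all $x$. An orthomodular algebra (OM algebra, meaning left-orthomodular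 algebra) is an involutive left-m-BE algebra satisfying $(x\odot y)\oplus((x\odot y)^*\odot x)=x$ for all $x,y\in X$, where $x\oplus y:=(x^*\odot y^* )^*$. *)

theory Defs
  imports "HOL-Algebra.Congruence"
begin

text \<open>
  Algebras are records with an explicit carrier set; all operations are total functions on the
  ambient type and are only constrained on the carrier.
\<close>

record 'a pointed = "'a partial_object" +
  unity :: 'a ("\<one>\<index>")

record 'a be = "'a pointed" +
  imp :: "'a \<Rightarrow> 'a \<Rightarrow> 'a" (infixr "\<^bold>\<rightarrow>\<index>" 65)

record 'a bounded_be = "'a be" +
  bzero :: 'a ("\<zero>\<index>")

record 'a m_be = "'a pointed" +
  mprod :: "'a \<Rightarrow> 'a \<Rightarrow> 'a" (infixl "\<odot>\<index>" 70)
  mstar :: "'a \<Rightarrow> 'a" ("_\<^sup>\<dagger>\<index>" [1000] 999)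

locale be_algebra =
  fixes A (structure)
  assumes unity_closed: "\<one> \<in> carrier A"
    and imp_closed: "\<lbrakk>x \<in> carrier A; y \<in> carrier A\<rbrakk> \<Longrightarrow> x \<^bold>\<rightarrow> y \<in> carrier A"
    and imp_refl: "x \<in> carrier A \<Longrightarrow> x \<^bold>\<rightarrow> x = \<one>"
    and imp_unity: "x \<in> carrier A \<Longrightarrow> x \<^bold>\<rightarrow> \<one> = \<one>"
    and unity_imp: "x \<in> carrier A \<Longrightarrow> \<one> \<^bold>\<rightarrow> x = x"
    and imp_exchange: "\<lbrakk>x \<in> carrier A; y \<in> carrier A; z \<in> carrier A\<rbrakk>
      \<Longrightarrow> x \<^bold>\<rightarrow> (y \<^bold>\<rightarrow> z) = y \<^bold>\<rightarrow> (x \<^bold>\<rightarrow> z)"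

definition be_le :: "('a, 'b) be_scheme \<Rightarrow> 'a \<Rightarrow> 'a \<Rightarrow> bool" (infix "\<preceq>\<index>" 50)
  where "x \<preceq>\<^bsub>A\<^esub> y \<longleftrightarrow> x \<^bold>\<rightarrow>\<^bsub>A\<^esub> y = \<one>\<^bsub>A\<^esub>"

text \<open>The bound is part of the signature, i.e. these are the algebras $(X, \to, 0, 1)$.\<close>

locale bounded_be_algebra = be_algebra A for A (structure) +
  assumes bzero_closed: "\<zero> \<in> carrier A"
    and bzero_le: "x \<in> carrier A \<Longrightarrow> \<zero> \<preceq> x"

definition be_neg :: "('a, 'b) bounded_be_scheme \<Rightarrow> 'a \<Rightarrow> 'a" ("_\<^sup>\<star>\<index>" [1000] 999)
  where "x\<^sup>\<star>\<^bsub>A\<^esub> = x \<^bold>\<rightarrow>\<^bsub>A\<^esub> \<zero>\<^bsub>A\<^esub>"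

locale involutive_be_algebra = bounded_be_algebra A for A (structure) +
  assumes neg_neg: "x \<in> carrier A \<Longrightarrow> (x\<^sup>\<star>)\<^sup>\<star> = x"

definition be_Cap :: "('a, 'b) bounded_be_scheme \<Rightarrow> 'a \<Rightarrow> 'a \<Rightarrow> 'a" (infixl "\<Cap>\<index>" 70)
  where "x \<Cap>\<^bsub>A\<^esub> y =
    ((x\<^sup>\<star>\<^bsub>A\<^esub> \<^bold>\<rightarrow>\<^bsub>A\<^esub> y\<^sup>\<star>\<^bsub>A\<^esub>) \<^bold>\<rightarrow>\<^bsub>A\<^esub> y\<^sup>\<star>\<^bsub>A\<^esub>)\<^sup>\<star>\<^bsub>A\<^esub>"

locale iom_algebra = involutive_be_algebra A for A (structure) +
  assumes iom: "\<lbrakk>x \<in> carrier A; y \<in> carrier A\<rbrakk> \<Longrightarrow> x \<Cap> (y \<^bold>\<rightarrow> x) = x"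

definition m_zero :: "('a, 'b) m_be_scheme \<Rightarrow> 'a" ("\<bottom>\<index>")
  where "\<bottom>\<^bsub>B\<^esub> = \<one>\<^bsub>B\<^esub>\<^sup>\<dagger>\<^bsub>B\<^esub>"

locale m_be_algebra =
  fixes B (structure)
  assumes unity_closed: "\<one> \<in> carrier B"
    and mprod_closed: "\<lbrakk>x \<in> carrier B; y \<in> carrier B\<rbrakk> \<Longrightarrow> x \<odot> y \<in> carrier B"
    and mstar_closed: "x \<in> carrier B \<Longrightarrow> x\<^sup>\<dagger> \<in> carrier B"
    and unity_mprod: "x \<in> carrier B \<Longrightarrow> \<one> \<odot> x = x"
    and mprod_unity: "x \<in> carrier B \<Longrightarrow> x \<odot> \<one> = x"
    and mprod_comm: "\<lbrakk>x \<in> carrier B; y \<in> carrier B\<rbrakk> \<Longrightarrow> x \<odot> y = y \<odot> x"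
    and mprod_assoc: "\<lbrakk>x \<in> carrier B; y \<in> carrier B; z \<in> carrier B\<rbrakk>
      \<Longrightarrow> x \<odot> (y \<odot> z) = (x \<odot> y) \<odot> z"
    and mprod_zero: "x \<in> carrier B \<Longrightarrow> x \<odot> \<bottom> = \<bottom>"
    and mprod_mstar: "x \<in> carrier B \<Longrightarrow> x \<odot> x\<^sup>\<dagger> = \<bottom>"

locale involutive_m_be_algebra = m_be_algebra B for B (structure) +
  assumes mstar_mstar: "x \<in> carrier B \<Longrightarrow> (x\<^sup>\<dagger>)\<^sup>\<dagger> = x"

definition m_sum :: "('a, 'b) m_be_scheme \<Rightarrow> 'a \<Rightarrow> 'a \<Rightarrow> 'a" (infixl "\<oplus>\<index>" 65)
  where "x \<oplus>\<^bsub>B\<^esub> y = (x\<^sup>\<dagger>\<^bsub>B\<^esub> \<odot>\<^bsub>B\<^esub> y\<^sup>\<dagger>\<^bsub>B\<^esub>)\<^sup>\<dagger>\<^bsub>B\<^esub>"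

locale om_algebra = involutive_m_be_algebra B for B (structure) +
  assumes om: "\<lbrakk>x \<in> carrier B; y \<in> carrier B\<rbrakk>
      \<Longrightarrow> (x \<odot> y) \<oplus> ((x \<odot> y)\<^sup>\<dagger> \<odot> x) = x"

definition Phi :: "'a bounded_be \<Rightarrow> 'a m_be"
  where "Phi A =
    \<lparr>carrier = carrier A,
     unity = \<one>\<^bsub>A\<^esub>,
     mprod = (\<lambda>x y. (x \<^bold>\<rightarrow>\<^bsub>A\<^esub> y\<^sup>\<star>\<^bsub>A\<^esub>)\<^sup>\<star>\<^bsub>A\<^esub>),
     mstar = (\<lambda>x. x\<^sup>\<star>\<^bsub>A\<^esub>)\<rparr>"

definition Psi :: "'a m_be \<Rightarrow> 'a bounded_be"
  where "Psi B =
    \<lparr>carrier = carrier B,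
     unity = \<one>\<^bsub>B\<^esub>,
     imp = (\<lambda>x y. (x \<odot>\<^bsub>B\<^esub> y\<^sup>\<dagger>\<^bsub>B\<^esub>)\<^sup>\<dagger>\<^bsub>B\<^esub>),
     bzero = \<bottom>\<^bsub>B\<^esub>\<rparr>"

text \<open>
  Equality as algebras: record equality would also compare the irrelevant values of the
  operations outside the carrier.
\<close>

definition be_eq :: "'a bounded_be \<Rightarrow> 'a bounded_be \<Rightarrow> bool"
  where "be_eq A A' \<longleftrightarrow>
    carrier A = carrier A' \<and> \<one>\<^bsub>A\<^esub> = \<one>\<^bsub>A'\<^esub> \<and> \<zero>\<^bsub>A\<^esub> = \<zero>\<^bsub>A'\<^esub> \<and>
    (\<forall>x\<in>carrier A. \<forall>y\<in>carrier A. x \<^bold>\<rightarrow>\<^bsub>A\<^esub> y = x \<^bold>\<rightarrow>\<^bsub>A'\<^esub> y)"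

definition m_eq :: "'a m_be \<Rightarrow> 'a m_be \<Rightarrow> bool"
  where "m_eq B B' \<longleftrightarrow>
    carrier B = carrier B' \<and> \<one>\<^bsub>B\<^esub> = \<one>\<^bsub>B'\<^esub> \<and>
    (\<forall>x\<in>carrier B. \<forall>y\<in>carrier B. x \<odot>\<^bsub>B\<^esub> y = x \<odot>\<^bsub>B'\<^esub> y) \<and>
    (\<forall>x\<in>carrier B. x\<^sup>\<dagger>\<^bsub>B\<^esub> = x\<^sup>\<dagger>\<^bsub>B'\<^esub>)"

end

theory Submission
  imports Defs
begin

text \<open>
  In an involutive BE algebra the exchange law with third argument \<open>\<zero>\<close> reads
  \<open>x \<rightarrow> y\<^sup>\<star> = y \<rightarrow> x\<^sup>\<star>\<close>, a form of contraposition. Moreover \<open>\<rightarrow>\<close> and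
  \<open>x \<odot> y = (x \<rightarrow> y\<^sup>\<star>)\<^sup>\<star>\<close> determine each other by double negation, and the exchange
  law is the same thing as commutativity together with associativity of \<open>\<odot>\<close>. So involutive BE
  algebras and involutive m-BE algebras already correspond to each other under \<open>\<Phi>\<close> and
  \<open>\<Psi>\<close>, and the two transformations are mutually inverse at that level.

  It remains to match the two additional laws. With \<open>u = x\<^sup>\<star>\<close> one has
  \<open>(y \<rightarrow> x)\<^sup>\<star> = u \<odot> y\<close>, and rewriting every \<open>\<rightarrow>\<close> in terms of \<open>\<odot>\<close> gives
  \[ x \Cap (y \to x) = \bigl((u \odot y) \oplus ((u \odot y)^* \odot u)\bigr)^*. \]
  So the implicative-orthomodular law at \<open>x, y\<close> is the negation of the orthomodular law at
  \<open>x\<^sup>\<star>, y\<close>; as \<open>\<star>\<close> is an involution of the carrier, either law holds everywhere iff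
  the other does. The lemmas \<open>Phi_om_term\<close> and \<open>Psi_Cap\<close> are the two versions of this identity.
\<close>

context involutive_be_algebra
begin

lemma neg_closed: "x \<in> carrier A \<Longrightarrow> x\<^sup>\<star> \<in> carrier A"
  by (simp add: be_neg_def imp_closed bzero_closed)

lemma neg_unity: "\<one>\<^sup>\<star> = \<zero>"
  by (simp add: be_neg_def unity_imp bzero_closed)

lemma neg_zero: "\<zero>\<^sup>\<star> = \<one>"
  by (simp add: be_neg_def imp_refl bzero_closed)

text \<open>
  This is the exchange law with third argument \<open>\<zero>\<close>. Negating both sides yields the
  commutativity of \<open>\<odot>\<close>.
\<close>

lemma imp_neg_commute:
  assumes "x \<in> carrier A" "y \<in> carrier A"
  shows "x \<^bold>\<rightarrow> y\<^sup>\<star> = y \<^bold>\<rightarrow> x\<^sup>\<star>"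
  using assms by (simp add: be_neg_def imp_exchange bzero_closed)

lemmas carrier_facts = unity_closed bzero_closed imp_closed neg_closed

end

lemma Phi_simps [simp]:
  "carrier (Phi A) = carrier A"
  "\<one>\<^bsub>Phi A\<^esub> = \<one>\<^bsub>A\<^esub>"
  "x \<odot>\<^bsub>Phi A\<^esub> y = (x \<^bold>\<rightarrow>\<^bsub>A\<^esub> y\<^sup>\<star>\<^bsub>A\<^esub>)\<^sup>\<star>\<^bsub>A\<^esub>"
  "x\<^sup>\<dagger>\<^bsub>Phi A\<^esub> = x\<^sup>\<star>\<^bsub>A\<^esub>"
  "\<bottom>\<^bsub>Phi A\<^esub> = \<one>\<^bsub>A\<^esub>\<^sup>\<star>\<^bsub>A\<^esub>"
  by (simp_all add: Phi_def m_zero_def)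

text \<open>
  Associativity is the exchange law in disguise: up to negation, \<open>x \<odot> (y \<odot> z)\<close> is
  \<open>x \<rightarrow> (z \<rightarrow> y\<^sup>\<star>)\<close> and \<open>(x \<odot> y) \<odot> z\<close> is \<open>z \<rightarrow> (x \<rightarrow> y\<^sup>\<star>)\<close>.
\<close>

lemma involutive_m_be_Phi:
  assumes "involutive_be_algebra A"
  shows "involutive_m_be_algebra (Phi A)"
proof -
  interpret involutive_be_algebra A by fact
  show ?thesis
  proof (unfold_locales, goal_cases)
    case (5 x)
    then show ?case
      using imp_neg_commute[of x "\<one>\<^bsub>A\<^esub>"] by (simp add: carrier_facts unity_imp neg_neg)
  next
    case (6 x y)
    then show ?case by (simp add: imp_neg_commute[of x y])
  next
    case (7 x y z)
    then have mem: "x \<in> carrier A" "y \<in> carrier A" "z \<in> carrier A" by simp_all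
    have "x \<^bold>\<rightarrow>\<^bsub>A\<^esub> (y \<^bold>\<rightarrow>\<^bsub>A\<^esub> z\<^sup>\<star>\<^bsub>A\<^esub>)
        = x \<^bold>\<rightarrow>\<^bsub>A\<^esub> (z \<^bold>\<rightarrow>\<^bsub>A\<^esub> y\<^sup>\<star>\<^bsub>A\<^esub>)"
      using mem by (simp add: imp_neg_commute)
    also have "\<dots> = z \<^bold>\<rightarrow>\<^bsub>A\<^esub> (x \<^bold>\<rightarrow>\<^bsub>A\<^esub> y\<^sup>\<star>\<^bsub>A\<^esub>)"
      using mem by (simp add: imp_exchange carrier_facts)
    also have "\<dots> = (x \<^bold>\<rightarrow>\<^bsub>A\<^esub> y\<^sup>\<star>\<^bsub>A\<^esub>)\<^sup>\<star>\<^bsub>A\<^esub> \<^bold>\<rightarrow>\<^bsub>A\<^esub> z\<^sup>\<star>\<^bsub>A\<^esub>"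
      using mem imp_neg_commute[of z "(x \<^bold>\<rightarrow>\<^bsub>A\<^esub> y\<^sup>\<star>\<^bsub>A\<^esub>)\<^sup>\<star>\<^bsub>A\<^esub>"]
      by (simp add: carrier_facts neg_neg)
    finally show ?case
      using mem by (simp add: carrier_facts neg_neg)
  qed (simp_all add: carrier_facts neg_neg neg_unity neg_zero imp_unity unity_imp imp_refl)
qed

text \<open>
  With \<open>q = x \<rightarrow> y\<^sup>\<star>\<close>, double negation reduces the orthomodular term to
  \<open>q \<rightarrow> (q \<rightarrow> x\<^sup>\<star>)\<^sup>\<star>\<close> and the negated meet to \<open>(x \<rightarrow> q\<^sup>\<star>) \<rightarrow> q\<^sup>\<star>\<close>;
  contraposing both arrows identifies the two.
\<close>

lemma Phi_om_term:
  fixes A (structure)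
  assumes "involutive_be_algebra A"
    and mem: "x \<in> carrier A" "y \<in> carrier A"
  shows "(x \<odot>\<^bsub>Phi A\<^esub> y) \<oplus>\<^bsub>Phi A\<^esub> ((x \<odot>\<^bsub>Phi A\<^esub> y)\<^sup>\<dagger>\<^bsub>Phi A\<^esub> \<odot>\<^bsub>Phi A\<^esub> x)
    = (x\<^sup>\<star> \<Cap> (y \<^bold>\<rightarrow> x\<^sup>\<star>))\<^sup>\<star>"
proof -
  interpret involutive_be_algebra A by fact
  define q where "q = x \<^bold>\<rightarrow> y\<^sup>\<star>"
  have q: "q \<in> carrier A" "y \<^bold>\<rightarrow> x\<^sup>\<star> = q"
    using mem by (simp_all add: q_def carrier_facts imp_neg_commute[of y x])
  have "(x \<^bold>\<rightarrow> q\<^sup>\<star>) \<^bold>\<rightarrow> q\<^sup>\<star> = q \<^bold>\<rightarrow> (q \<^bold>\<rightarrow> x\<^sup>\<star>)\<^sup>\<star>"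
    using mem q(1) by (simp add: carrier_facts imp_neg_commute[of _ q])
  then show ?thesis
    using mem q by (simp add: m_sum_def be_Cap_def carrier_facts neg_neg flip: q_def)
qed

lemma om_Phi:
  assumes "iom_algebra A"
  shows "om_algebra (Phi A)"
proof -
  interpret iom_algebra A by fact
  interpret P: involutive_m_be_algebra "Phi A"
    by (intro involutive_m_be_Phi) unfold_locales
  show ?thesis
  proof (unfold_locales, goal_cases)
    case (1 x y)
    then have "x \<in> carrier A" "y \<in> carrier A" by simp_all
    then show ?case
      using iom[of "x\<^sup>\<star>\<^bsub>A\<^esub>" y]
      by (simp only: Phi_om_term[OF involutive_be_algebra_axioms] neg_closed neg_neg)
  qed
qed

lemma (in m_be_algebra) zero_closed: "\<bottom> \<in> carrier B"
  by (simp add: m_zero_def mstar_closed unity_closed)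

lemma (in m_be_algebra) zero_mprod: "x \<in> carrier B \<Longrightarrow> \<bottom> \<odot> x = \<bottom>"
  using mprod_comm[of \<bottom> x] by (simp add: zero_closed mprod_zero)

lemma (in m_be_algebra) mprod_left_commute:
  "\<lbrakk>x \<in> carrier B; y \<in> carrier B; z \<in> carrier B\<rbrakk> \<Longrightarrow> x \<odot> (y \<odot> z) = y \<odot> (x \<odot> z)"
  by (simp add: mprod_assoc mprod_comm[of x y])

context involutive_m_be_algebra
begin

lemma mstar_unity: "\<one>\<^sup>\<dagger> = \<bottom>"
  by (simp add: m_zero_def)

lemma mstar_zero: "\<bottom>\<^sup>\<dagger> = \<one>"
  by (simp add: m_zero_def mstar_mstar unity_closed)

lemmas carrier_facts = unity_closed zero_closed mprod_closed mstar_closed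

end

lemma Psi_simps [simp]:
  "carrier (Psi B) = carrier B"
  "\<one>\<^bsub>Psi B\<^esub> = \<one>\<^bsub>B\<^esub>"
  "\<zero>\<^bsub>Psi B\<^esub> = \<bottom>\<^bsub>B\<^esub>"
  "x \<^bold>\<rightarrow>\<^bsub>Psi B\<^esub> y = (x \<odot>\<^bsub>B\<^esub> y\<^sup>\<dagger>\<^bsub>B\<^esub>)\<^sup>\<dagger>\<^bsub>B\<^esub>"
  by (simp_all add: Psi_def)

lemma neg_Psi:
  assumes "involutive_m_be_algebra B" "x \<in> carrier B"
  shows "x\<^sup>\<star>\<^bsub>Psi B\<^esub> = x\<^sup>\<dagger>\<^bsub>B\<^esub>"
proof -
  interpret involutive_m_be_algebra B by fact
  show ?thesis
    using assms(2) by (simp add: be_neg_def mstar_zero mprod_unity)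
qed

text \<open>
  The exchange law becomes \<open>x \<odot> (y \<odot> z\<^sup>\<dagger>) = y \<odot> (x \<odot> z\<^sup>\<dagger>)\<close>, the left commutativity
  of a commutative semigroup.
\<close>

lemma involutive_be_Psi:
  assumes "involutive_m_be_algebra B"
  shows "involutive_be_algebra (Psi B)"
proof -
  interpret involutive_m_be_algebra B by fact
  show ?thesis
    by unfold_locales
      (simp_all add: carrier_facts neg_Psi[OF assms] be_le_def mstar_mstar mstar_zero mstar_unity
        mprod_mstar mprod_zero zero_mprod unity_mprod mprod_left_commute)
qed

text \<open>
  With \<open>p = x\<^sup>\<dagger> \<odot> y\<close>, so that \<open>y \<rightarrow> x = p\<^sup>\<dagger>\<close>, both sides unfold to the product of
  \<open>p\<^sup>\<dagger>\<close> with \<open>(p\<^sup>\<dagger> \<odot> x\<^sup>\<dagger>)\<^sup>\<dagger>\<close>, up to the order of the factors.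
\<close>

lemma Psi_Cap:
  fixes B (structure)
  assumes B: "involutive_m_be_algebra B"
    and mem: "x \<in> carrier B" "y \<in> carrier B"
  shows "x \<Cap>\<^bsub>Psi B\<^esub> (y \<^bold>\<rightarrow>\<^bsub>Psi B\<^esub> x)
    = ((x\<^sup>\<dagger> \<odot> y) \<oplus> ((x\<^sup>\<dagger> \<odot> y)\<^sup>\<dagger> \<odot> x\<^sup>\<dagger>))\<^sup>\<dagger>"
proof -
  interpret involutive_m_be_algebra B by fact
  define p where "p = x\<^sup>\<dagger> \<odot> y"
  have p: "p \<in> carrier B" "y \<odot> x\<^sup>\<dagger> = p"
    using mem by (simp_all add: p_def carrier_facts mprod_comm)
  have "(x\<^sup>\<dagger> \<odot> p\<^sup>\<dagger>)\<^sup>\<dagger> \<odot> p\<^sup>\<dagger> = p\<^sup>\<dagger> \<odot> (p\<^sup>\<dagger> \<odot> x\<^sup>\<dagger>)\<^sup>\<dagger>"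
    using mem p(1) by (simp add: carrier_facts mprod_comm)
  then show ?thesis
    using mem p
    by (simp add: be_Cap_def m_sum_def neg_Psi[OF B] carrier_facts mstar_mstar flip: p_def)
qed

lemma iom_Psi:
  assumes "om_algebra B"
  shows "iom_algebra (Psi B)"
proof -
  interpret om_algebra B by fact
  interpret P: involutive_be_algebra "Psi B"
    by (intro involutive_be_Psi) unfold_locales
  show ?thesis
  proof (unfold_locales, goal_cases)
    case (1 x y)
    then have "x \<in> carrier B" "y \<in> carrier B" by simp_all
    then show ?case
      using om[of "x\<^sup>\<dagger>\<^bsub>B\<^esub>" y]
      by (simp only: Psi_Cap[OF involutive_m_be_algebra_axioms] mstar_closed mstar_mstar)
  qed
qed

lemma Psi_Phi:
  assumes "involutive_be_algebra A"
  shows "be_eq (Psi (Phi A)) A"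
proof -
  interpret involutive_be_algebra A by fact
  show ?thesis by (simp add: be_eq_def carrier_facts neg_neg neg_unity)
qed

lemma Phi_Psi:
  assumes "involutive_m_be_algebra B"
  shows "m_eq (Phi (Psi B)) B"
proof -
  interpret involutive_m_be_algebra B by fact
  show ?thesis by (simp add: m_eq_def neg_Psi[OF assms] carrier_facts mstar_mstar)
qed

theorem proposition3p4:
  shows "(\<forall>A :: 'a bounded_be. iom_algebra A \<longrightarrow> om_algebra (Phi A)) \<and>
    (\<forall>B :: 'a m_be. om_algebra B \<longrightarrow> iom_algebra (Psi B)) \<and>
    (\<forall>A :: 'a bounded_be. iom_algebra A \<longrightarrow> be_eq (Psi (Phi A)) A) \<and>
    (\<forall>B :: 'a m_be. om_algebra B \<longrightarrow> m_eq (Phi (Psi B)) B)"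
  by (simp add: om_Phi iom_Psi Psi_Phi Phi_Psi
      iom_algebra.axioms(1) om_algebra.axioms(1))

end
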